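(* Let $F\colon\mathcal H\to\mathcal K$ be a frame, let $\mathcal A=H_*+\mathcal A(F)$, where $H_*$ is a self-adjoint operator on $\mathcal H$, let $\lambda\in\mathbb R$ be essentially regular, let $H_0\in\mathcal A$ be resonant at $\lambda$, let $V\in\mathcal A(F)$ be a regularizing direction for $H_0$ at $\lambda$, and let $H_r=H_0+rV$, $r\in\mathbb R$. For $s\in\mathbb R$ such that $H_s$ is regular at $\lambda$, let $N_\pm(s)$ be the numbers of up-poles and down-poles in the group of the resonance point $r=0$, computed from $H_s$. Then the resonance index $\mathrm{ind}_{res}(\lambda;H_0,V)=N_+(s)-N_-(s)$ does not depend on the choice of the regular operator $H_s$ on the affine line $\{H_r:r\in\mathbb R\}$.
   Context: $\mathcal H$ is a complex separable Hilbert space. A frame is a Hilbert–Schmidt operator $F\colon\mathcal H\to\mathcal K$ into another Hilbert space with trivial kernel and co-kernel (injective with dense range). $\mathcal A(F)$ is the set of operators $V=F^*JF$ with $J$ bounded self-adjoint on $\mathcal K$ ($J$ is determined by $V$). $R_z(H)=(H-z)^{-1}$, $T_z(H)=FR_z(H)F^*$. $\Lambda(H,F)$ is the set of $\lambda\in\mathbb R$ for which $T_{\lambda+i0}(H)=\lim_{y\to0^+}T_{\lambda+iy}(H)$ exists in operator norm and $\lim_{y\to0^+}\mathrm{Im}\,T_{\lambda+iy}(H)$ exists in trace norm. $\lambda$ is essentially regular if $\lambda\in\Lambda(H,F)$ for some $H\in\mathcal A$; $H\in\mathcal A$ is regular at $\lambda$ if $\lambda\in\Lambda(H,F)$ and resonant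 at $\lambda$ otherwise. $V\in\mathcal A(F)$ is a regularizing direction for a resonant $H_0$ if $H_0+rV$ is regular at $\lambda$ for some $r\in\mathbb R$; then the set of $r$ with $H_r$ resonant is discrete. Definition of $N_\pm(s)$: with $V=F^*JF$ and $H_s$ regular at $\lambda$, consider the meromorphic function $\sigma\mapsto(1+\sigma T_z(H_s)J)^{-1}$. A number $\sigma_0$ is a pole iff $-1/\sigma_0$ is an eigenvalue of $T_z(H_s)J$, and the multiplicity of the pole is the algebraic multiplicity of this eigenvalue. For $z=\lambda+i0$ the point $\sigma_0=-s$ (corresponding to $H_s+\sigma_0V=H_0$) is a pole, of multiplicity $N$, say. For $z=\lambda+iy$ with small $y>0$ there are no real poles and the pole $-s$ splits into a group of exactly $N$ nearby poles (counted with multiplicity); $N_+(s)$ of them lie in the open upper half-plane (up-poles) and $N_-(s)$ in the open lower half-plane (down-poles). *)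

theory Defs
  imports "HOL-Analysis.Analysis" "HOL-Complex_Analysis.Complex_Analysis"
begin

section \<open>Complex Hilbert spaces\<close>

text \<open>
  The inner product is linear in its first argument.  Its positivity and the fact that it
  induces the norm come from the real inner product, which is its real part.
\<close>

class complex_inner_space = real_inner +
  fixes scaleC :: "complex \<Rightarrow> 'a \<Rightarrow> 'a" (infixr "*\<^sub>C" 75)
    and cinner :: "'a \<Rightarrow> 'a \<Rightarrow> complex"
  assumes scaleC_add_right: "c *\<^sub>C (x + y) = c *\<^sub>C x + c *\<^sub>C y"
    and scaleC_add_left: "(c + d) *\<^sub>C x = c *\<^sub>C x + d *\<^sub>C x"
    and scaleC_scaleC: "c *\<^sub>C (d *\<^sub>C x) = (c * d) *\<^sub>C x"
    and scaleR_scaleC: "scaleR r x = complex_of_real r *\<^sub>C x"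
    and cinner_commute: "cinner x y = cnj (cinner y x)"
    and cinner_add_left: "cinner (x + y) z = cinner x z + cinner y z"
    and cinner_scaleC_left: "cinner (c *\<^sub>C x) y = c * cinner x y"
    and Re_cinner: "Re (cinner x y) = inner x y"

class chilbert_space = complex_inner_space + complete_space

instantiation complex :: chilbert_space
begin

definition scaleC_complex :: "complex \<Rightarrow> complex \<Rightarrow> complex"
  where "scaleC_complex c x = c * x"

definition cinner_complex :: "complex \<Rightarrow> complex \<Rightarrow> complex"
  where "cinner_complex x y = x * cnj y"

instance
  by standard
    (auto simp: scaleC_complex_def cinner_complex_def algebra_simps scaleR_conv_of_real
      inner_complex_def)

end

lemma norm_scaleC: "norm (c *\<^sub>C (x::'a::complex_inner_space)) = cmod c * norm x"
proof -
  have im: "Im (cinner x x) = 0"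
    using cinner_commute[of x x] by (metis complex_cnj cnj.sel(2) equal_neg_zero)
  have "cinner (c *\<^sub>C x) (c *\<^sub>C x) = c * cnj (cinner (c *\<^sub>C x) x)"
    by (metis cinner_scaleC_left cinner_commute)
  also have "\<dots> = (c * cnj c) * cnj (cinner x x)"
    by (simp add: cinner_scaleC_left)
  also have "\<dots> = complex_of_real ((cmod c)\<^sup>2) * cnj (cinner x x)"
    by (simp only: complex_norm_square)
  finally have "inner (c *\<^sub>C x) (c *\<^sub>C x) = (cmod c)\<^sup>2 * inner x x"
    using im by (metis Re_cinner Re_complex_of_real complex_cnj_complex_of_real
        complex_eq_iff complex_is_Real_iff cnj.sel(1) Im_complex_of_real of_real_mult
        of_real_Re)
  then show ?thesis
    by (simp add: norm_eq_sqrt_inner real_sqrt_mult)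
qed

lemma vector_space_scaleC:
  "vector_space (scaleC :: complex \<Rightarrow> 'a \<Rightarrow> 'a::complex_inner_space)"
proof
  show "1 *\<^sub>C x = x" for x :: 'a
    using scaleR_scaleC[of 1 x] by simp
qed (simp_all add: scaleC_add_right scaleC_add_left scaleC_scaleC)

definition is_onb :: "'a::complex_inner_space set \<Rightarrow> bool" where
  "is_onb B \<longleftrightarrow> (\<forall>e\<in>B. norm e = 1) \<and> (\<forall>e\<in>B. \<forall>f\<in>B. e \<noteq> f \<longrightarrow> cinner e f = 0) \<and>
     closure (module.span scaleC B) = UNIV"


section \<open>Bounded operators\<close>

text \<open>
  A bounded operator is an element of the library type of bounded real-linear maps that is in
  addition complex-linear; the norm of that type is the operator norm.
\<close>

definition clin :: "('a::complex_inner_space \<Rightarrow>\<^sub>L 'b::complex_inner_space) \<Rightarrow> bool" where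
  "clin A \<longleftrightarrow> (\<forall>c x. A (c *\<^sub>C x) = c *\<^sub>C A x)"

lift_definition scaleC_op ::
    "complex \<Rightarrow> 'a::real_normed_vector \<Rightarrow>\<^sub>L 'b::complex_inner_space \<Rightarrow> 'a \<Rightarrow>\<^sub>L 'b"
  is "\<lambda>c A x. c *\<^sub>C A x"
proof -
  fix c :: complex and A :: "'a \<Rightarrow> 'b"
  assume A: "bounded_linear A"
  have "bounded_linear (\<lambda>x::'b. c *\<^sub>C x)"
    by (rule bounded_linear_intro[where K = "cmod c"])
      (simp_all add: scaleC_add_right scaleR_scaleC scaleC_scaleC norm_scaleC mult.commute)
  then show "bounded_linear (\<lambda>x. c *\<^sub>C A x)"
    using A by (rule bounded_linear_compose)
qed

definition adj :: "('a::complex_inner_space \<Rightarrow>\<^sub>L 'b::complex_inner_space) \<Rightarrow> 'b \<Rightarrow>\<^sub>L 'a" where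
  "adj A = (THE B::'b \<Rightarrow>\<^sub>L 'a. \<forall>x y. cinner (A x) y = cinner x (B y))"

definition bounded_selfadjoint :: "('a::complex_inner_space \<Rightarrow>\<^sub>L 'a) \<Rightarrow> bool" where
  "bounded_selfadjoint A \<longleftrightarrow> clin A \<and> (\<forall>x y. cinner (A x) y = cinner x (A y))"

definition positive_op :: "('a::complex_inner_space \<Rightarrow>\<^sub>L 'a) \<Rightarrow> bool" where
  "positive_op A \<longleftrightarrow> bounded_selfadjoint A \<and> (\<forall>x. Re (cinner (A x) x) \<ge> 0)"

definition Im_op :: "('a::complex_inner_space \<Rightarrow>\<^sub>L 'a) \<Rightarrow> 'a \<Rightarrow>\<^sub>L 'a" where
  "Im_op A = scaleC_op (1 / (2 * \<i>)) (A - adj A)"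

text \<open>The value \<open>0\<close> at non-invertible operators is a dummy.\<close>

definition inv_op :: "('a::complex_inner_space \<Rightarrow>\<^sub>L 'a) \<Rightarrow> 'a \<Rightarrow>\<^sub>L 'a" where
  "inv_op A = (if \<exists>B. A o\<^sub>L B = id_blinfun \<and> B o\<^sub>L A = id_blinfun
     then THE B. A o\<^sub>L B = id_blinfun \<and> B o\<^sub>L A = id_blinfun else 0)"

definition hilbert_schmidt ::
    "('a::complex_inner_space \<Rightarrow>\<^sub>L 'b::complex_inner_space) \<Rightarrow> bool" where
  "hilbert_schmidt A \<longleftrightarrow> clin A \<and>
     (\<exists>B. is_onb B \<and> (\<lambda>e. (norm (A e))\<^sup>2) summable_on B)"

definition abs_op :: "('a::complex_inner_space \<Rightarrow>\<^sub>L 'a) \<Rightarrow> 'a \<Rightarrow>\<^sub>L 'a" where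
  "abs_op A = (THE P. positive_op P \<and> P o\<^sub>L P = adj A o\<^sub>L A)"

text \<open>The trace of \<open>|A|\<close>, infinite if \<open>A\<close> is not of trace class; it does not depend on the
  orthonormal basis.\<close>

definition trace_norm :: "('a::complex_inner_space \<Rightarrow>\<^sub>L 'a) \<Rightarrow> ennreal" where
  "trace_norm A = (\<Sum>\<^sub>\<infinity>e\<in>(SOME B. is_onb B). ennreal (Re (cinner (abs_op A e) e)))"

definition root_space :: "('a::complex_inner_space \<Rightarrow>\<^sub>L 'a) \<Rightarrow> complex \<Rightarrow> 'a set" where
  "root_space A \<mu> = {x. \<exists>k::nat. ((\<lambda>v. A v - \<mu> *\<^sub>C v) ^^ k) x = 0}"

text \<open>Only used where the root space is finite-dimensional (the dimension of the library is
  \<open>0\<close> for infinite-dimensional spaces).\<close>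

definition alg_mult :: "('a::complex_inner_space \<Rightarrow>\<^sub>L 'a) \<Rightarrow> complex \<Rightarrow> nat" where
  "alg_mult A \<mu> = vector_space.dim scaleC (root_space A \<mu>)"


section \<open>Unbounded operators\<close>

text \<open>Possibly unbounded operators are given by their graphs.\<close>

definition is_operator :: "('a::complex_inner_space \<times> 'a) set \<Rightarrow> bool" where
  "is_operator H \<longleftrightarrow> single_valued H \<and> (0, 0) \<in> H \<and>
     (\<forall>(x, y)\<in>H. \<forall>(x', y')\<in>H. (x + x', y + y') \<in> H) \<and>
     (\<forall>c. \<forall>(x, y)\<in>H. (c *\<^sub>C x, c *\<^sub>C y) \<in> H)"

definition adjoint_graph :: "('a::complex_inner_space \<times> 'a) set \<Rightarrow> ('a \<times> 'a) set" where
  "adjoint_graph H = {(u, w). \<forall>(x, y)\<in>H. cinner y u = cinner x w}"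

definition self_adjoint :: "('a::complex_inner_space \<times> 'a) set \<Rightarrow> bool" where
  "self_adjoint H \<longleftrightarrow> is_operator H \<and> closure (Domain H) = UNIV \<and> adjoint_graph H = H"

definition op_plus :: "('a::complex_inner_space \<times> 'a) set \<Rightarrow> ('a \<Rightarrow>\<^sub>L 'a) \<Rightarrow> ('a \<times> 'a) set"
    (infixl "+\<^sub>O" 65) where
  "H +\<^sub>O V = {(x, y + V x) |x y. (x, y) \<in> H}"

text \<open>\<open>R\<^sub>z(H) x\<close> is the solution \<open>u\<close> of \<open>H u - z u = x\<close>; only used for \<open>z\<close> in the
  resolvent set.\<close>

definition resolvent ::
    "('a::complex_inner_space \<times> 'a) set \<Rightarrow> complex \<Rightarrow> 'a \<Rightarrow>\<^sub>L 'a" where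
  "resolvent H z = Blinfun (\<lambda>x. THE u. (u, x + z *\<^sub>C u) \<in> H)"


section \<open>Frames and regular operators\<close>

definition is_frame :: "('h::chilbert_space \<Rightarrow>\<^sub>L 'k::chilbert_space) \<Rightarrow> bool" where
  "is_frame F \<longleftrightarrow> hilbert_schmidt F \<and> inj (blinfun_apply F) \<and>
     closure (range (blinfun_apply F)) = UNIV"

definition frame_ops :: "('h::chilbert_space \<Rightarrow>\<^sub>L 'k::chilbert_space) \<Rightarrow> ('h \<Rightarrow>\<^sub>L 'h) set" where
  "frame_ops F = {adj F o\<^sub>L J o\<^sub>L F |J. bounded_selfadjoint J}"

definition J_of ::
    "('h::chilbert_space \<Rightarrow>\<^sub>L 'k::chilbert_space) \<Rightarrow> ('h \<Rightarrow>\<^sub>L 'h) \<Rightarrow> 'k \<Rightarrow>\<^sub>L 'k" where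
  "J_of F V = (THE J. bounded_selfadjoint J \<and> V = adj F o\<^sub>L J o\<^sub>L F)"

definition affine_ops :: "('h::chilbert_space \<times> 'h) set \<Rightarrow> ('h \<Rightarrow>\<^sub>L 'k::chilbert_space)
    \<Rightarrow> ('h \<times> 'h) set set" where
  "affine_ops H F = {H +\<^sub>O V |V. V \<in> frame_ops F}"

definition sandwiched ::
    "('h::chilbert_space \<Rightarrow>\<^sub>L 'k::chilbert_space) \<Rightarrow> ('h \<times> 'h) set \<Rightarrow> complex \<Rightarrow> 'k \<Rightarrow>\<^sub>L 'k" where
  "sandwiched F H z = F o\<^sub>L resolvent H z o\<^sub>L adj F"

definition sandwiched_limit ::
    "('h::chilbert_space \<Rightarrow>\<^sub>L 'k::chilbert_space) \<Rightarrow> ('h \<times> 'h) set \<Rightarrow> real \<Rightarrow> 'k \<Rightarrow>\<^sub>L 'k" where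
  "sandwiched_limit F H l = Lim (at_right 0) (\<lambda>y. sandwiched F H (Complex l y))"

definition Lambda ::
    "('h::chilbert_space \<times> 'h) set \<Rightarrow> ('h \<Rightarrow>\<^sub>L 'k::chilbert_space) \<Rightarrow> real set" where
  "Lambda H F = {l.
     (\<exists>L. ((\<lambda>y. sandwiched F H (Complex l y)) \<longlongrightarrow> L) (at_right 0)) \<and>
     (\<exists>M. clin M \<and> trace_norm M < \<infinity> \<and>
       ((\<lambda>y. trace_norm (Im_op (sandwiched F H (Complex l y)) - M)) \<longlongrightarrow> 0) (at_right 0))}"

definition essentially_regular ::
    "('h::chilbert_space \<times> 'h) set set \<Rightarrow> ('h \<Rightarrow>\<^sub>L 'k::chilbert_space) \<Rightarrow> real \<Rightarrow> bool" where
  "essentially_regular \<A> F l \<longleftrightarrow> (\<exists>H\<in>\<A>. l \<in> Lambda H F)"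

abbreviation regular_at ::
    "real \<Rightarrow> ('h::chilbert_space \<Rightarrow>\<^sub>L 'k::chilbert_space) \<Rightarrow> ('h \<times> 'h) set \<Rightarrow> bool" where
  "regular_at l F H \<equiv> l \<in> Lambda H F"

abbreviation resonant_at ::
    "real \<Rightarrow> ('h::chilbert_space \<Rightarrow>\<^sub>L 'k::chilbert_space) \<Rightarrow> ('h \<times> 'h) set \<Rightarrow> bool" where
  "resonant_at l F H \<equiv> l \<notin> Lambda H F"

definition regularizing :: "real \<Rightarrow> ('h::chilbert_space \<Rightarrow>\<^sub>L 'k::chilbert_space)
    \<Rightarrow> ('h \<times> 'h) set \<Rightarrow> ('h \<Rightarrow>\<^sub>L 'h) \<Rightarrow> bool" where
  "regularizing l F H V \<longleftrightarrow> (\<exists>r::real. regular_at l F (H +\<^sub>O r *\<^sub>R V))"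


section \<open>The resonance index\<close>

definition pole_function :: "('a::complex_inner_space \<Rightarrow>\<^sub>L 'a) \<Rightarrow> complex \<Rightarrow> 'a \<Rightarrow>\<^sub>L 'a" where
  "pole_function A \<sigma> = inv_op (id_blinfun + scaleC_op \<sigma> A)"

definition pole_mult :: "('a::complex_inner_space \<Rightarrow>\<^sub>L 'a) \<Rightarrow> complex \<Rightarrow> nat" where
  "pole_mult A \<sigma> = alg_mult A (- 1 / \<sigma>)"

definition count_poles :: "('a::complex_inner_space \<Rightarrow>\<^sub>L 'a) \<Rightarrow> complex set \<Rightarrow> nat" where
  "count_poles A S = (\<Sum>\<sigma> | \<sigma> \<in> S \<and> is_pole (pole_function A) \<sigma>. pole_mult A \<sigma>)"

text \<open>
  The group of the resonance point \<open>r = 0\<close>, seen from \<open>H = H\<^sub>s\<close>: for every small radius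
  \<open>\<epsilon>\<close>, as soon as \<open>y > 0\<close> is small enough, the poles for \<open>z = l + i y\<close> in the disc of radius
  \<open>\<epsilon>\<close> about \<open>-s\<close> are as many as the multiplicity of the pole \<open>-s\<close> for \<open>z = l + i 0\<close>.
  \<open>N_half P\<close> is the number of them that lie in \<open>P\<close>.
\<close>

definition N_half :: "complex set \<Rightarrow> real \<Rightarrow> ('h::chilbert_space \<Rightarrow>\<^sub>L 'k::chilbert_space)
    \<Rightarrow> ('h \<times> 'h) set \<Rightarrow> ('h \<Rightarrow>\<^sub>L 'h) \<Rightarrow> real \<Rightarrow> nat" where
  "N_half P l F H V s = (THE n.
     \<forall>\<^sub>F \<epsilon> in at_right 0. \<forall>\<^sub>F y in at_right 0.
       count_poles (sandwiched F H (Complex l y) o\<^sub>L J_of F V) (ball (- of_real s) \<epsilon>)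
         = pole_mult (sandwiched_limit F H l o\<^sub>L J_of F V) (- of_real s) \<and>
       count_poles (sandwiched F H (Complex l y) o\<^sub>L J_of F V) (ball (- of_real s) \<epsilon> \<inter> P) = n)"

definition N_plus :: "real \<Rightarrow> ('h::chilbert_space \<Rightarrow>\<^sub>L 'k::chilbert_space)
    \<Rightarrow> ('h \<times> 'h) set \<Rightarrow> ('h \<Rightarrow>\<^sub>L 'h) \<Rightarrow> real \<Rightarrow> nat" where
  "N_plus l F H0 V s = N_half {\<sigma>. Im \<sigma> > 0} l F (H0 +\<^sub>O s *\<^sub>R V) V s"

definition N_minus :: "real \<Rightarrow> ('h::chilbert_space \<Rightarrow>\<^sub>L 'k::chilbert_space)
    \<Rightarrow> ('h \<times> 'h) set \<Rightarrow> ('h \<Rightarrow>\<^sub>L 'h) \<Rightarrow> real \<Rightarrow> nat" where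
  "N_minus l F H0 V s = N_half {\<sigma>. Im \<sigma> < 0} l F (H0 +\<^sub>O s *\<^sub>R V) V s"

definition resonance_index :: "real \<Rightarrow> ('h::chilbert_space \<Rightarrow>\<^sub>L 'k::chilbert_space)
    \<Rightarrow> ('h \<times> 'h) set \<Rightarrow> ('h \<Rightarrow>\<^sub>L 'h) \<Rightarrow> real \<Rightarrow> int" where
  "resonance_index l F H0 V s = int (N_plus l F H0 V s) - int (N_minus l F H0 V s)"

end

theory Submission
  imports Defs
begin

text \<open>
  Fix \<open>z\<close> off the real axis and put \<open>A\<^sub>r = T\<^sub>z(H\<^sub>r) J\<close>.  The second resolvent identity for the
  perturbation \<open>(t - s) V = (t - s) F\<^sup>* J F\<close>, multiplied by \<open>F\<close> and \<open>F\<^sup>*\<close>, says that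
  \<open>A\<^sub>s - A\<^sub>t = (t - s) A\<^sub>s A\<^sub>t = (t - s) A\<^sub>t A\<^sub>s\<close>; in other words \<open>1 + (t - s) A\<^sub>s\<close> is invertible with
  inverse \<open>1 - (t - s) A\<^sub>t\<close> and \<open>A\<^sub>t\<close> is the Moebius transform \<open>A\<^sub>s (1 + (t - s) A\<^sub>s)\<^sup>-\<^sup>1\<close>.  Hence
  \<open>1 + \<sigma> A\<^sub>t = (1 + (\<sigma> + t - s) A\<^sub>s) (1 - (t - s) A\<^sub>t)\<close>,
  with an invertible last factor that commutes with the others and does not depend on \<open>\<sigma>\<close>.
  Two consequences follow.  The poles seen from \<open>H\<^sub>t\<close> are the poles seen from \<open>H\<^sub>s\<close>, translated
  by the real number \<open>s - t\<close>, and corresponding poles have the same root space, hence the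
  same multiplicity.

  The translation takes the disc of radius \<open>\<epsilon>\<close> about \<open>-s\<close> to the one about \<open>-t\<close> and preserves
  both half-planes, so for every small \<open>\<epsilon>\<close> and every \<open>y > 0\<close> the counts for \<open>s\<close> and \<open>t\<close> agree.
  At regular \<open>H\<^sub>s\<close> and \<open>H\<^sub>t\<close> the identity survives the limit \<open>y \<rightarrow> 0\<close>, so the total multiplicity
  \<open>N\<close> of the group is also the same.  The conditions that define \<open>N\<^sub>\<plusminus>(s)\<close> and \<open>N\<^sub>\<plusminus>(t)\<close> are
  therefore equivalent, and even \<open>N\<^sub>+\<close> and \<open>N\<^sub>-\<close> separately are independent of the base point.
  Resonance of \<open>H\<^sub>0\<close> enters by excluding \<open>s = 0\<close> and \<open>t = 0\<close>: the discs have to avoid the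
  point \<open>0\<close>, to which no eigenvalue \<open>-1/\<sigma>\<close> corresponds.

  The functional analysis behind this is the existence of adjoints, the fact that a
  self-adjoint operator stays self-adjoint under a bounded self-adjoint perturbation and has a
  resolvent off the real axis, and the uniqueness of \<open>J\<close> in \<open>V = F\<^sup>* J F\<close>, which comes from
  the dense range of \<open>F\<close>.
\<close>

section \<open>Projections and adjoints in Hilbert spaces\<close>

text \<open>
  The vector is \<open>x - p\<close> for the point \<open>p\<close> of \<open>M\<close> closest to \<open>x\<close>, which exists because the
  parallelogram law makes every minimising sequence a Cauchy sequence.
\<close>

lemma closed_subspace_orthogonal_vector:
  fixes M :: "'a::{real_inner, complete_space} set"
  assumes M: "subspace M" "closed M" and x: "x \<notin> M"
  obtains u where "u \<noteq> 0" "\<And>m. m \<in> M \<Longrightarrow> inner m u = 0"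
proof -
  define d where "d = infdist x M"
  have ne: "M \<noteq> {}" using M(1) subspace_0 by blast
  have d0: "d \<ge> 0" by (simp add: d_def infdist_nonneg)
  have dle: "d \<le> norm (x - m)" if "m \<in> M" for m
    using infdist_le[OF that, of x] by (simp add: d_def dist_norm)
  have "\<exists>m\<in>M. norm (x - m) < d + 1 / Suc n" for n
  proof (rule ccontr)
    assume "\<not> ?thesis"
    then have "\<And>m. m \<in> M \<Longrightarrow> d + 1 / Suc n \<le> dist x m" by (force simp: dist_norm)
    then have "d + 1 / Suc n \<le> infdist x M"
      unfolding infdist_notempty[OF ne] by (intro cINF_greatest[OF ne])
    then show False by (simp add: d_def)
  qed
  then obtain y where yM: "\<And>n. y n \<in> M" and y: "\<And>n. norm (x - y n) < d + 1 / Suc n"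
    by metis
  \<comment> \<open>Parallelogram law: the midpoint of two nearly closest points lies in \<open>M\<close> as well, so it
      is at distance at least \<open>d\<close> from \<open>x\<close> and the two points are close to each other.\<close>
  have par: "(norm (y m - y n))\<^sup>2 \<le> (8 * d + 4) * e"
    if e: "1 / Suc m \<le> e" "1 / Suc n \<le> e" "e \<le> 1" for m n e
  proof -
    have mid: "(1/2) *\<^sub>R (y m + y n) \<in> M"
      using yM M(1) by (simp add: subspace_add subspace_scale)
    have "(norm (y m - y n))\<^sup>2 = 2 * (norm (x - y m))\<^sup>2 + 2 * (norm (x - y n))\<^sup>2
        - 4 * (norm (x - (1/2) *\<^sub>R (y m + y n)))\<^sup>2"
      by (simp add: power2_norm_eq_inner inner_diff inner_add inner_commute algebra_simps)
    moreover have "(norm (x - y m))\<^sup>2 \<le> (d + e)\<^sup>2" "(norm (x - y n))\<^sup>2 \<le> (d + e)\<^sup>2"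
      using y[of m] y[of n] e by (auto intro!: power_mono)
    moreover have "d\<^sup>2 \<le> (norm (x - (1/2) *\<^sub>R (y m + y n)))\<^sup>2"
      using dle[OF mid] d0 by (auto intro!: power_mono)
    ultimately have "(norm (y m - y n))\<^sup>2 \<le> 4 * (d + e)\<^sup>2 - 4 * d\<^sup>2" by simp
    also have "\<dots> = 8 * d * e + 4 * (e * e)" by (simp add: power2_eq_square algebra_simps)
    also have "e * e \<le> e" using e by (simp add: mult_left_le_one_le order_trans[of 0 "1 / Suc m"])
    finally show ?thesis by (simp add: algebra_simps)
  qed
  have "Cauchy y"
  proof (rule metric_CauchyI)
    fix e :: real assume e: "e > 0"
    define c where "c = min 1 (e\<^sup>2 / (8 * d + 5))"
    have c: "c > 0" "c \<le> 1" "c \<le> e\<^sup>2 / (8 * d + 5)" using e d0 by (auto simp: c_def)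
    have "(8 * d + 4) * c < (8 * d + 5) * c" using c by simp
    also have "\<dots> \<le> e\<^sup>2" using c(3) d0 by (simp add: field_simps)
    finally have ce: "(8 * d + 4) * c < e\<^sup>2" .
    obtain N where N: "1 / Suc N < c" using c(1) nat_approx_posE by blast
    have "dist (y m) (y n) < e" if "m \<ge> N" "n \<ge> N" for m n
    proof -
      have "1 / Suc m \<le> 1 / Suc N" "1 / Suc n \<le> 1 / Suc N" using that by (auto simp: frac_le)
      then have "(norm (y m - y n))\<^sup>2 \<le> (8 * d + 4) * c" using N c by (intro par) auto
      then have "(norm (y m - y n))\<^sup>2 < e\<^sup>2" using ce by simp
      then show ?thesis using e by (simp add: dist_norm power_less_imp_less_base)
    qed
    then show "\<exists>N. \<forall>m\<ge>N. \<forall>n\<ge>N. dist (y m) (y n) < e" by blast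
  qed
  then obtain p where p: "y \<longlonglongrightarrow> p" using Cauchy_convergent convergent_def by blast
  have pM: "p \<in> M" using M(2) p yM closed_sequentially by blast
  have "(\<lambda>n. d + 1 / Suc n) \<longlonglongrightarrow> d + 0"
    by (intro tendsto_intros LIMSEQ_Suc[OF lim_1_over_n])
  moreover have "(\<lambda>n. norm (x - y n)) \<longlonglongrightarrow> norm (x - p)" by (intro tendsto_intros p)
  ultimately have xp: "norm (x - p) \<le> d"
    using y by (intro LIMSEQ_le[of _ _ "\<lambda>n. d + 1 / Suc n"]) (auto intro: less_imp_le)
  have "inner m (x - p) = 0" if m: "m \<in> M" for m
  proof (cases "m = 0")
    case False
    \<comment> \<open>Moving \<open>p\<close> by the component of \<open>x - p\<close> along \<open>m\<close>, were it nonzero, would bring it closer to \<open>x\<close>.\<close>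
    define a where "a = inner m (x - p) / inner m m"
    have "p + a *\<^sub>R m \<in> M" using pM m M(1) by (simp add: subspace_add subspace_scale)
    then have "(norm (x - p))\<^sup>2 \<le> (norm (x - (p + a *\<^sub>R m)))\<^sup>2"
      using dle xp by (meson order_trans norm_ge_zero power_mono)
    also have "\<dots> = (norm (x - p))\<^sup>2 - 2 * a * inner m (x - p) + a * a * inner m m"
      by (simp add: power2_norm_eq_inner inner_diff inner_add inner_commute algebra_simps)
    also have "\<dots> = (norm (x - p))\<^sup>2 - (inner m (x - p))\<^sup>2 / inner m m"
      using False by (simp add: a_def power2_eq_square field_simps)
    finally have "(inner m (x - p))\<^sup>2 / inner m m \<le> 0" by simp
    then show ?thesis using False by (simp add: divide_le_0_iff) (smt (verit) inner_gt_zero_iff)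
  qed simp
  moreover have "x - p \<noteq> 0" using pM x by auto
  ultimately show ?thesis using that by blast
qed

lemma riesz_representation:
  fixes f :: "'a::{real_inner, complete_space} \<Rightarrow> real"
  assumes f: "bounded_linear f"
  obtains w where "\<And>x. f x = inner x w"
proof (cases "\<forall>x. f x = 0")
  case True
  then show ?thesis using that[of 0] by simp
next
  case False
  interpret f: bounded_linear f by fact
  define M where "M = {x. f x = 0}"
  have "subspace M" by (simp add: M_def subspace_def f.add f.scaleR)
  moreover have "closed M"
    unfolding M_def by (intro closed_Collect_eq f.continuous_on continuous_intros)
  moreover obtain x where "x \<notin> M" using False M_def by blast
  ultimately obtain u where u: "u \<noteq> 0" "\<And>m. m \<in> M \<Longrightarrow> inner m u = 0"
    using closed_subspace_orthogonal_vector by blast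
  then have fu: "f u \<noteq> 0" by (force simp: M_def)
  have "f x = inner x ((f u / inner u u) *\<^sub>R u)" for x
  proof -
    have "x - (f x / f u) *\<^sub>R u \<in> M" using fu by (simp add: M_def f.diff f.scaleR)
    then have "inner (x - (f x / f u) *\<^sub>R u) u = 0" by (rule u)
    then show ?thesis using u(1) fu by (simp add: inner_diff field_simps)
  qed
  then show ?thesis using that by blast
qed

lemma bounded_linear_scaleC: "bounded_linear (\<lambda>x::'a::complex_inner_space. c *\<^sub>C x)"
  by (rule bounded_linear_intro[where K = "cmod c"])
    (simp_all add: scaleC_add_right scaleR_scaleC scaleC_scaleC norm_scaleC mult.commute)

lemma scaleC_diff_right: "c *\<^sub>C (x - y) = c *\<^sub>C x - c *\<^sub>C y"
  for x y :: "'a::complex_inner_space"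
proof -
  interpret bounded_linear "\<lambda>x::'a. c *\<^sub>C x" by (rule bounded_linear_scaleC)
  show ?thesis by (rule diff)
qed

lemma scaleC_one: "1 *\<^sub>C x = x"
  for x :: "'a::complex_inner_space"
  using scaleR_scaleC[of 1 x] by simp

lemma scaleC_diff_left: "(c - d) *\<^sub>C x = c *\<^sub>C x - d *\<^sub>C x"
  for x :: "'a::complex_inner_space"
  by (metis add_diff_cancel diff_add_cancel scaleC_add_left)

text \<open>
  Reduces complex orthogonality, continuity and adjoints to the real inner product, where
  the library lemmas apply.
\<close>

lemma cinner_eq_inner: "cinner x y = Complex (inner x y) (inner (- \<i> *\<^sub>C x) y)"
  by (simp add: complex_eq_iff cinner_scaleC_left flip: Re_cinner)

lemma cinner_diff_left: "cinner (x - y) z = cinner x z - cinner y z"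
  by (metis add_diff_cancel cinner_add_left diff_add_cancel)

lemma cinner_add_right: "cinner x (y + z) = cinner x y + cinner x z"
  by (metis cinner_add_left cinner_commute complex_cnj_add)

lemma cinner_diff_right: "cinner x (y - z) = cinner x y - cinner x z"
  by (metis cinner_diff_left cinner_commute complex_cnj_diff)

lemma cinner_scaleC_right: "cinner x (c *\<^sub>C y) = cnj c * cinner x y"
  by (metis cinner_commute cinner_scaleC_left complex_cnj_mult)

lemma cinner_scaleR_left: "cinner (r *\<^sub>R x) y = of_real r * cinner x y"
  by (simp add: scaleR_scaleC cinner_scaleC_left)

lemma cinner_scaleR_right: "cinner x (r *\<^sub>R y) = of_real r * cinner x y"
  by (simp add: scaleR_scaleC cinner_scaleC_right)

lemmas cinner_simps = cinner_add_left cinner_add_right cinner_diff_left cinner_diff_right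
  cinner_scaleC_left cinner_scaleC_right cinner_scaleR_left cinner_scaleR_right

lemma cinner_self: "cinner x x = of_real ((norm x)\<^sup>2)"
proof -
  have "Im (cinner x x) = 0"
    using cinner_commute[of x x] by (metis complex_cnj cnj.sel(2) equal_neg_zero)
  then show ?thesis by (simp add: complex_eq_iff Re_cinner power2_norm_eq_inner)
qed

lemma cinner_ext_right: "(\<And>x. cinner x y = cinner x z) \<Longrightarrow> y = z"
  by (metis Re_cinner vector_eq_ldot)

lemma abs_Im_cinner_le: "\<bar>Im (cinner x y)\<bar> \<le> norm x * norm y"
  using Cauchy_Schwarz_ineq2[of "- \<i> *\<^sub>C x" y]
  by (simp add: cinner_eq_inner norm_scaleC)

lemma tendsto_cinner:
  "(f \<longlongrightarrow> x) G \<Longrightarrow> (g \<longlongrightarrow> y) G \<Longrightarrow> ((\<lambda>t. cinner (f t) (g t)) \<longlongrightarrow> cinner x y) G"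
  unfolding cinner_eq_inner
  by (intro tendsto_intros bounded_linear.tendsto[OF bounded_linear_scaleC])

lemma clin_compose: "clin A \<Longrightarrow> clin B \<Longrightarrow> clin (A o\<^sub>L B)"
  by (simp add: clin_def)

text \<open>
  By Riesz representation the real functional \<open>x \<mapsto> inner (A x) y\<close> is represented by a vector
  that depends linearly and boundedly on \<open>y\<close>; complex linearity of \<open>A\<close> upgrades the identity
  to the complex inner product.  This is the existence that the definite description in
  \<^const>\<open>adj\<close> presupposes.
\<close>

lemma cinner_adj:
  fixes A :: "'a::chilbert_space \<Rightarrow>\<^sub>L 'b::chilbert_space"
  assumes A: "clin A"
  shows "cinner (A x) y = cinner x (adj A y)"
proof -
  have "\<exists>w. \<forall>x. inner (A x) y = inner x w" for y
  proof -
    have "bounded_linear (\<lambda>x. inner (A x) y)"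
      by (intro bounded_linear_intros)
    then show ?thesis by (meson riesz_representation)
  qed
  then obtain B where B: "\<And>x y. inner (A x) y = inner x (B y)" by metis
  have "bounded_linear B"
  proof (rule bounded_linear_intro[where K = "norm A"])
    show "B (x + y) = B x + B y" for x y
      by (rule vector_eq_ldot[THEN iffD1]) (simp add: inner_add_right flip: B)
    show "B (r *\<^sub>R x) = r *\<^sub>R B x" for r x
      by (rule vector_eq_ldot[THEN iffD1]) (simp flip: B)
    show "norm (B y) \<le> norm y * norm A" for y
    proof -
      have "norm (B y) * norm (B y) = inner (A (B y)) y"
        by (simp add: B flip: power2_norm_eq_inner power2_eq_square)
      also have "\<dots> \<le> norm (A (B y)) * norm y" by (rule norm_cauchy_schwarz)
      also have "\<dots> \<le> norm A * norm (B y) * norm y"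
        by (intro mult_right_mono norm_blinfun) auto
      finally show ?thesis
        by (cases "norm (B y) = 0") (auto simp: mult_ac)
    qed
  qed
  then have BB: "blinfun_apply (Blinfun B) = B" by (simp add: bounded_linear_Blinfun_apply)
  have cB: "cinner (A x) y = cinner x (Blinfun B y)" for x y
    using A by (simp add: cinner_eq_inner BB clin_def flip: B)
  have "\<forall>x y. cinner (A x) y = cinner x (adj A y)"
    unfolding adj_def
  proof (rule theI[of _ "Blinfun B"])
    show "\<forall>x y. cinner (A x) y = cinner x (Blinfun B y)" using cB by blast
    show "C = Blinfun B" if "\<forall>x y. cinner (A x) y = cinner x (C y)" for C :: "'b \<Rightarrow>\<^sub>L 'a"
      by (rule blinfun_eqI, rule cinner_ext_right) (metis that cB)
  qed
  then show ?thesis by blast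
qed

lemma cinner_adj_left:
  fixes A :: "'a::chilbert_space \<Rightarrow>\<^sub>L 'b::chilbert_space"
  shows "clin A \<Longrightarrow> cinner (adj A y) x = cinner y (A x)"
  by (metis cinner_adj cinner_commute)

lemma symmetric_imp_clin:
  fixes A :: "'a::complex_inner_space \<Rightarrow>\<^sub>L 'a"
  shows "(\<And>x y. cinner (A x) y = cinner x (A y)) \<Longrightarrow> clin A"
  unfolding clin_def
  by (intro allI, rule cinner_ext_right) (metis cinner_scaleC_right)

lemma clin_adj:
  fixes A :: "'a::chilbert_space \<Rightarrow>\<^sub>L 'b::chilbert_space"
  shows "clin A \<Longrightarrow> clin (adj A)"
  unfolding clin_def
  by (intro allI, rule cinner_ext_right) (metis cinner_scaleC_right cinner_adj clin_def)

lemma clin_limit: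
  fixes A :: "'c \<Rightarrow> 'a::complex_inner_space \<Rightarrow>\<^sub>L 'b::complex_inner_space"
  assumes "(A \<longlongrightarrow> L) G" "eventually (\<lambda>t. clin (A t)) G" "G \<noteq> bot"
  shows "clin L"
  unfolding clin_def
proof (intro allI)
  fix c x
  have "((\<lambda>t. A t (c *\<^sub>C x)) \<longlongrightarrow> L (c *\<^sub>C x)) G"
    by (intro tendsto_intros assms)
  then have "((\<lambda>t. c *\<^sub>C A t x) \<longlongrightarrow> L (c *\<^sub>C x)) G"
    by (rule Lim_transform_eventually)
      (use assms(2) in eventually_elim, simp add: clin_def)
  moreover have "((\<lambda>t. c *\<^sub>C A t x) \<longlongrightarrow> c *\<^sub>C L x) G"
    by (intro bounded_linear.tendsto[OF bounded_linear_scaleC] tendsto_intros assms)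
  ultimately show "L (c *\<^sub>C x) = c *\<^sub>C L x"
    using assms(3) tendsto_unique by blast
qed


section \<open>Resolvents of self-adjoint operators\<close>

lemma mem_op_plus: "(u, h) \<in> H +\<^sub>O V \<longleftrightarrow> (u, h - V u) \<in> H"
  unfolding op_plus_def by (auto intro: exI[where x = "h - V u"])

lemma op_plus_assoc: "H +\<^sub>O V +\<^sub>O W = H +\<^sub>O (V + W)"
  by (auto simp: mem_op_plus blinfun.bilinear_simps algebra_simps)

lemma self_adjoint_op_plus:
  assumes H: "self_adjoint H" and V: "bounded_selfadjoint V"
  shows "self_adjoint (H +\<^sub>O V)"
proof -
  have Hop: "is_operator H" and dom: "closure (Domain H) = UNIV" and adjH: "adjoint_graph H = H"
    using H by (auto simp: self_adjoint_def)
  have sv: "single_valued H" and zero: "(0, 0) \<in> H"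
    and add: "\<And>x y x' y'. (x, y) \<in> H \<Longrightarrow> (x', y') \<in> H \<Longrightarrow> (x + x', y + y') \<in> H"
    and scl: "\<And>c x y. (x, y) \<in> H \<Longrightarrow> (c *\<^sub>C x, c *\<^sub>C y) \<in> H"
    using Hop unfolding is_operator_def by blast+
  have "is_operator (H +\<^sub>O V)"
    unfolding is_operator_def
  proof (intro conjI ballI allI, safe)
    show "single_valued (H +\<^sub>O V)"
    proof (rule single_valuedI)
      fix x y y' assume "(x, y) \<in> H +\<^sub>O V" "(x, y') \<in> H +\<^sub>O V"
      then have "y - V x = y' - V x" using sv by (auto simp: mem_op_plus dest: single_valuedD)
      then show "y = y'" by simp
    qed
    show "(0, 0) \<in> H +\<^sub>O V" using zero by (simp add: mem_op_plus blinfun.bilinear_simps)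
    show "(x + x', y + y') \<in> H +\<^sub>O V" if "(x, y) \<in> H +\<^sub>O V" "(x', y') \<in> H +\<^sub>O V" for x y x' y'
      using add[of x "y - V x" x' "y' - V x'"] that
      by (simp add: mem_op_plus blinfun.add_right algebra_simps)
    show "(c *\<^sub>C x, c *\<^sub>C y) \<in> H +\<^sub>O V" if "(x, y) \<in> H +\<^sub>O V" for c x y
      using scl[of x "y - V x" c] that V scaleC_diff_right[of c y "V x"]
      by (simp add: mem_op_plus bounded_selfadjoint_def clin_def)
  qed
  moreover have "Domain (H +\<^sub>O V) = Domain H"
    by (auto simp: op_plus_def)
  moreover have "adjoint_graph (H +\<^sub>O V) = H +\<^sub>O V"
  proof (intro set_eqI, clarify)
    fix u w
    have "(u, w) \<in> adjoint_graph (H +\<^sub>O V) \<longleftrightarrow> (\<forall>(x, y)\<in>H. cinner (y + V x) u = cinner x w)"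
      unfolding adjoint_graph_def op_plus_def by blast
    also have "\<dots> \<longleftrightarrow> (u, w - V u) \<in> adjoint_graph H"
      using V unfolding adjoint_graph_def bounded_selfadjoint_def
      by (auto simp: cinner_simps algebra_simps split: prod.splits)
    finally show "(u, w) \<in> adjoint_graph (H +\<^sub>O V) \<longleftrightarrow> (u, w) \<in> H +\<^sub>O V"
      by (simp add: adjH mem_op_plus)
  qed
  ultimately show ?thesis using dom by (simp add: self_adjoint_def)
qed

text \<open>
  The number \<open>\<langle>H u, u\<rangle>\<close> is real, so with \<open>H u = x + z u\<close> the imaginary part of \<open>\<langle>x, u\<rangle>\<close> equals
  \<open>- Im z * (norm u)\<^sup>2\<close>; then Cauchy-Schwarz.  The bound yields uniqueness of solutions of
  \<open>(H - z) u = x\<close>, closedness of the range of \<open>H - z\<close> and boundedness of the resolvent.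
\<close>

lemma self_adjoint_lower_bound:
  assumes H: "self_adjoint H" and u: "(u, x + z *\<^sub>C u) \<in> H"
  shows "\<bar>Im z\<bar> * norm u \<le> norm x"
proof -
  have "(u, x + z *\<^sub>C u) \<in> adjoint_graph H" using H u by (simp add: self_adjoint_def)
  then have "cinner (x + z *\<^sub>C u) u = cinner u (x + z *\<^sub>C u)"
    using u by (auto simp: adjoint_graph_def)
  then have "Im (cinner (x + z *\<^sub>C u) u) = - Im (cinner (x + z *\<^sub>C u) u)"
    by (metis cinner_commute complex_cnj cnj.sel(2))
  then have "Im z * (norm u)\<^sup>2 = - Im (cinner x u)"
    by (simp add: cinner_simps cinner_self)
  then have "\<bar>Im z\<bar> * (norm u)\<^sup>2 \<le> norm x * norm u"
    using abs_Im_cinner_le[of x u] by (metis abs_minus_cancel abs_mult abs_power2 abs_norm_cancel power_abs)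
  then show ?thesis
    by (cases "norm u = 0") (auto simp: power2_eq_square)
qed

lemma is_operator_diff:
  fixes H :: "('a::complex_inner_space \<times> 'a) set"
  assumes "is_operator H" "(x, y) \<in> H" "(x', y') \<in> H"
  shows "(x - x', y - y') \<in> H"
proof -
  have neg: "(- 1) *\<^sub>C v = - v" for v :: 'a
    using scaleR_scaleC[of "-1" v] by simp
  have "((- 1) *\<^sub>C x', (- 1) *\<^sub>C y') \<in> H"
    using assms(1,3) unfolding is_operator_def by blast
  then have "(x + (- 1) *\<^sub>C x', y + (- 1) *\<^sub>C y') \<in> H"
    using assms(1,2) unfolding is_operator_def by blast
  then show ?thesis by (simp add: neg)
qed

lemma self_adjoint_solution_unique:
  fixes H :: "('a::complex_inner_space \<times> 'a) set"
  assumes H: "self_adjoint H" and z: "Im z \<noteq> 0"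
    and u: "(u, x + z *\<^sub>C u) \<in> H" and v: "(v, x + z *\<^sub>C v) \<in> H"
  shows "u = v"
proof -
  have "(u - v, (x + z *\<^sub>C u) - (x + z *\<^sub>C v)) \<in> H"
    using H u v by (intro is_operator_diff) (auto simp: self_adjoint_def)
  then have "(u - v, 0 + z *\<^sub>C (u - v)) \<in> H"
    using scaleC_diff_right[of z u v] by simp
  then have "\<bar>Im z\<bar> * norm (u - v) \<le> norm (0::'a)" by (rule self_adjoint_lower_bound[OF H])
  then show ?thesis using z by (simp add: mult_le_0_iff)
qed

text \<open>
  The range of \<open>H - z\<close> is closed, because \<open>H\<close> is a closed operator that is bounded below
  after the shift.  A vector orthogonal to the range is an eigenvector of \<open>H\<^sup>* = H\<close> for the
  non-real number \<open>cnj z\<close>, hence zero.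
\<close>

lemma self_adjoint_solution_exists:
  fixes H :: "('a::chilbert_space \<times> 'a) set"
  assumes H: "self_adjoint H" and z: "Im z \<noteq> 0"
  shows "\<exists>u. (u, x + z *\<^sub>C u) \<in> H"
proof (rule ccontr)
  define M where "M = {x. \<exists>u. (u, x + z *\<^sub>C u) \<in> H}"
  assume "\<not> ?thesis"
  then have x: "x \<notin> M" by (simp add: M_def)
  have Hop: "is_operator H" and adjH: "adjoint_graph H = H"
    using H by (auto simp: self_adjoint_def)
  have zero: "(0, 0) \<in> H"
    and add: "\<And>x y x' y'. (x, y) \<in> H \<Longrightarrow> (x', y') \<in> H \<Longrightarrow> (x + x', y + y') \<in> H"
    and scl: "\<And>c x y. (x, y) \<in> H \<Longrightarrow> (c *\<^sub>C x, c *\<^sub>C y) \<in> H"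
    using Hop unfolding is_operator_def by blast+
  interpret zl: bounded_linear "\<lambda>x::'a. z *\<^sub>C x" by (rule bounded_linear_scaleC)
  have Mscl: "c *\<^sub>C m \<in> M" if m: "m \<in> M" for c m
  proof -
    obtain u where "(u, m + z *\<^sub>C u) \<in> H" using m by (auto simp: M_def)
    from scl[OF this, of c] have "(c *\<^sub>C u, c *\<^sub>C m + z *\<^sub>C (c *\<^sub>C u)) \<in> H"
      by (simp add: scaleC_add_right scaleC_scaleC mult.commute)
    then show ?thesis by (auto simp: M_def)
  qed
  have "subspace M"
    unfolding subspace_def
  proof (intro conjI ballI allI)
    have "(0, 0 + z *\<^sub>C 0) \<in> H" using zero by (simp add: zl.zero)
    then show "0 \<in> M" unfolding M_def by blast
    show "a + b \<in> M" if ab: "a \<in> M" "b \<in> M" for a b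
    proof -
      obtain u v where "(u, a + z *\<^sub>C u) \<in> H" "(v, b + z *\<^sub>C v) \<in> H" using ab by (auto simp: M_def)
      from add[OF this] have "(u + v, (a + b) + z *\<^sub>C (u + v)) \<in> H"
        by (simp add: zl.add algebra_simps)
      then show ?thesis by (auto simp: M_def)
    qed
    show "c *\<^sub>R a \<in> M" if "a \<in> M" for c a
      using Mscl[OF that] by (simp add: scaleR_scaleC)
  qed
  moreover have "closed M"
    unfolding closed_sequential_limits
  proof (intro allI impI, elim conjE)
    fix f l
    assume f: "\<forall>n. f n \<in> M" and l: "f \<longlonglongrightarrow> l"
    obtain u where u: "\<And>n. (u n, f n + z *\<^sub>C u n) \<in> H" using f unfolding M_def by (auto, metis)
    have ubd: "\<bar>Im z\<bar> * norm (u m - u n) \<le> norm (f m - f n)" for m n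
    proof (rule self_adjoint_lower_bound[OF H])
      show "(u m - u n, (f m - f n) + z *\<^sub>C (u m - u n)) \<in> H"
        using is_operator_diff[OF Hop u[of m] u[of n]] by (simp add: zl.diff algebra_simps)
    qed
    have "Cauchy u"
    proof (rule metric_CauchyI)
      fix e :: real assume "e > 0"
      then have "\<bar>Im z\<bar> * e > 0" using z by simp
      then obtain N where N: "\<And>m n. m \<ge> N \<Longrightarrow> n \<ge> N \<Longrightarrow> dist (f m) (f n) < \<bar>Im z\<bar> * e"
        using LIMSEQ_imp_Cauchy[OF l] metric_CauchyD by blast
      have "dist (u m) (u n) < e" if "m \<ge> N" "n \<ge> N" for m n
      proof -
        have "\<bar>Im z\<bar> * norm (u m - u n) < \<bar>Im z\<bar> * e"
          using ubd[of m n] N[OF that] by (simp add: dist_norm)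
        then show ?thesis using z by (simp add: dist_norm)
      qed
      then show "\<exists>N. \<forall>m\<ge>N. \<forall>n\<ge>N. dist (u m) (u n) < e" by blast
    qed
    then obtain v where v: "u \<longlonglongrightarrow> v" using Cauchy_convergent convergent_def by blast
    have "(v, l + z *\<^sub>C v) \<in> adjoint_graph H"
      unfolding adjoint_graph_def
    proof clarify
      fix a b assume ab: "(a, b) \<in> H"
      have "(\<lambda>n. cinner b (u n)) \<longlonglongrightarrow> cinner b v"
        by (intro tendsto_cinner tendsto_const v)
      moreover have "(\<lambda>n. cinner a (f n + z *\<^sub>C u n)) \<longlonglongrightarrow> cinner a (l + z *\<^sub>C v)"
        by (intro tendsto_cinner tendsto_intros l zl.tendsto v)
      moreover have "cinner b (u n) = cinner a (f n + z *\<^sub>C u n)" for n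
        using u[of n] ab adjH by (force simp: adjoint_graph_def)
      ultimately show "cinner b v = cinner a (l + z *\<^sub>C v)"
        using LIMSEQ_unique by (metis (no_types, lifting) ext)
    qed
    then show "l \<in> M" using adjH by (auto simp: M_def)
  qed
  ultimately obtain w where w0: "w \<noteq> 0" and w: "\<And>m. m \<in> M \<Longrightarrow> inner m w = 0"
    using closed_subspace_orthogonal_vector x by blast
  \<comment> \<open>The range is stable under multiplication by \<open>\<i>\<close>, so real orthogonality is complex.\<close>
  have cw: "cinner m w = 0" if "m \<in> M" for m
    using w[OF that] w[OF Mscl[OF that, of "- \<i>"]] by (simp add: cinner_eq_inner complex_eq_iff)
  have "(w, 0 + cnj z *\<^sub>C w) \<in> adjoint_graph H"
    unfolding adjoint_graph_def
  proof clarify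
    fix a b assume "(a, b) \<in> H"
    then have "b - z *\<^sub>C a \<in> M" by (auto simp: M_def intro!: exI[of _ a])
    from cw[OF this] show "cinner b w = cinner a (0 + cnj z *\<^sub>C w)"
      by (simp add: cinner_simps)
  qed
  then have "\<bar>Im (cnj z)\<bar> * norm w \<le> norm (0::'a)"
    using self_adjoint_lower_bound[OF H] adjH by metis
  then show False using z w0 by (simp add: mult_le_0_iff)
qed

lemma resolvent_solves:
  fixes H :: "('a::chilbert_space \<times> 'a) set"
  assumes H: "self_adjoint H" and z: "Im z \<noteq> 0"
  shows "(resolvent H z x, x + z *\<^sub>C resolvent H z x) \<in> H"
proof -
  define R where "R x = (THE u. (u, x + z *\<^sub>C u) \<in> H)" for x
  have R: "(R x, x + z *\<^sub>C R x) \<in> H" for x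
    unfolding R_def
    by (rule theI') (use self_adjoint_solution_exists[OF assms]
        self_adjoint_solution_unique[OF assms] in blast)
  have Req: "R x = u" if "(u, x + z *\<^sub>C u) \<in> H" for x u
    using self_adjoint_solution_unique[OF assms R that] .
  have add: "\<And>x y x' y'. (x, y) \<in> H \<Longrightarrow> (x', y') \<in> H \<Longrightarrow> (x + x', y + y') \<in> H"
    and scl: "\<And>c x y. (x, y) \<in> H \<Longrightarrow> (c *\<^sub>C x, c *\<^sub>C y) \<in> H"
    using H unfolding self_adjoint_def is_operator_def by blast+
  have "bounded_linear R"
  proof (rule bounded_linear_intro[where K = "1 / \<bar>Im z\<bar>"])
    show "R (x + y) = R x + R y" for x y
      using add[OF R[of x] R[of y]] by (intro Req) (simp add: scaleC_add_right algebra_simps)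
    show "R (r *\<^sub>R x) = r *\<^sub>R R x" for r x
      using scl[OF R[of x], of r]
      by (intro Req) (simp add: scaleR_scaleC scaleC_add_right scaleC_scaleC mult.commute)
    show "norm (R x) \<le> norm x * (1 / \<bar>Im z\<bar>)" for x
      using self_adjoint_lower_bound[OF H R[of x]] z by (simp add: field_simps)
  qed
  then show ?thesis
    using R by (simp add: resolvent_def bounded_linear_Blinfun_apply flip: R_def)
qed

lemma resolvent_eqI:
  fixes H :: "('a::chilbert_space \<times> 'a) set"
  assumes "self_adjoint H" "Im z \<noteq> 0" "(u, x + z *\<^sub>C u) \<in> H"
  shows "resolvent H z x = u"
  using self_adjoint_solution_unique[OF assms(1,2) resolvent_solves[OF assms(1,2)] assms(3)] .

lemma clin_resolvent:
  fixes H :: "('a::chilbert_space \<times> 'a) set"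
  assumes "self_adjoint H" "Im z \<noteq> 0"
  shows "clin (resolvent H z)"
  unfolding clin_def
proof (intro allI)
  fix c x
  have "(c *\<^sub>C resolvent H z x, c *\<^sub>C (x + z *\<^sub>C resolvent H z x)) \<in> H"
    using resolvent_solves[OF assms, of x] assms(1) unfolding self_adjoint_def is_operator_def
    by blast
  then show "resolvent H z (c *\<^sub>C x) = c *\<^sub>C resolvent H z x"
    by (intro resolvent_eqI[OF assms]) (simp add: scaleC_add_right scaleC_scaleC mult.commute)
qed

text \<open>
  If \<open>u = R\<^sub>z(H + V) x\<close> then \<open>(H - z) u = x - V u\<close>, that is \<open>u = R\<^sub>z(H) (x - V u)\<close>.
\<close>

lemma second_resolvent_identity:
  fixes H :: "('a::chilbert_space \<times> 'a) set"
  assumes H: "self_adjoint H" and HV: "self_adjoint (H +\<^sub>O V)" and z: "Im z \<noteq> 0"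
  shows "resolvent H z x - resolvent (H +\<^sub>O V) z x = resolvent H z (V (resolvent (H +\<^sub>O V) z x))"
proof -
  define u where "u = resolvent (H +\<^sub>O V) z x"
  have "(u, (x - V u) + z *\<^sub>C u) \<in> H"
    using resolvent_solves[OF HV z, of x] by (simp add: mem_op_plus u_def algebra_simps)
  then have "resolvent H z (x - V u) = u" by (rule resolvent_eqI[OF H z])
  then show ?thesis by (simp add: u_def blinfun.diff_right algebra_simps)
qed


section \<open>Sandwiched resolvents along an affine line\<close>

lemma frame_clin: "is_frame F \<Longrightarrow> clin F"
  by (simp add: is_frame_def hilbert_schmidt_def)

lemma frame_ops_bounded_selfadjoint:
  fixes F :: "'h::chilbert_space \<Rightarrow>\<^sub>L 'k::chilbert_space"
  assumes F: "clin F" and V: "V \<in> frame_ops F"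
  shows "bounded_selfadjoint V"
proof -
  obtain J where J: "bounded_selfadjoint J" and VJ: "V = adj F o\<^sub>L J o\<^sub>L F"
    using V by (auto simp: frame_ops_def)
  have sym: "cinner (V x) y = cinner x (V y)" for x y
    using J by (simp add: VJ cinner_adj_left[OF F] bounded_selfadjoint_def
        flip: cinner_adj[OF F])
  then show ?thesis by (auto simp: bounded_selfadjoint_def intro: symmetric_imp_clin)
qed

lemma bounded_selfadjoint_scaleR:
  "bounded_selfadjoint V \<Longrightarrow> bounded_selfadjoint (r *\<^sub>R V)"
  by (simp add: bounded_selfadjoint_def clin_def scaleR_scaleC scaleC_scaleC cinner_simps
      blinfun.scaleR_left mult.commute)

lemma eq_if_eq_on_dense_range:
  fixes A B :: "'b::real_normed_vector \<Rightarrow>\<^sub>L 'c::real_normed_vector"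
  assumes dense: "closure (range F) = UNIV" and eq: "\<And>x. A (F x) = B (F x)"
  shows "A = B"
proof (rule blinfun_eqI)
  fix v
  have "closure (range F) \<subseteq> {v. A v = B v}"
    using eq by (intro closure_minimal closed_Collect_eq) (auto intro!: continuous_intros)
  then show "A v = B v" using dense by auto
qed

lemma adj_inj_if_dense_range:
  fixes F :: "'h::chilbert_space \<Rightarrow>\<^sub>L 'k::chilbert_space"
  assumes F: "clin F" and dense: "closure (range (blinfun_apply F)) = UNIV"
    and eq: "adj F v = adj F w"
  shows "v = w"
proof -
  have "cinner (F x) (v - w) = 0" for x
    using eq by (simp add: cinner_adj[OF F] cinner_diff_right)
  then have "inner (F x) (v - w) = 0" for x
    by (simp flip: Re_cinner)
  then have "closure (range (blinfun_apply F)) \<subseteq> {u. inner u (v - w) = 0}"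
    by (intro closure_minimal closed_Collect_eq) (auto intro!: continuous_intros)
  then have "v - w \<in> {u. inner u (v - w) = 0}" using dense by blast
  then show ?thesis by simp
qed

text \<open>
  An operator \<open>J\<close> is determined by \<open>F\<^sup>* J F\<close>: the dense range of \<open>F\<close> makes \<open>F\<^sup>*\<close> injective, and
  bounded operators that agree on a dense set are equal.
\<close>

lemma J_of_represents:
  fixes F :: "'h::chilbert_space \<Rightarrow>\<^sub>L 'k::chilbert_space"
  assumes F: "is_frame F" and V: "V \<in> frame_ops F"
  shows "bounded_selfadjoint (J_of F V)" "V = adj F o\<^sub>L J_of F V o\<^sub>L F"
proof -
  have dense: "closure (range (blinfun_apply F)) = UNIV" using F by (simp add: is_frame_def)
  have "\<exists>!J. bounded_selfadjoint J \<and> V = adj F o\<^sub>L J o\<^sub>L F"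
  proof (rule ex_ex1I)
    show "\<exists>J. bounded_selfadjoint J \<and> V = adj F o\<^sub>L J o\<^sub>L F"
      using V by (auto simp: frame_ops_def)
    fix J J'
    assume "bounded_selfadjoint J \<and> V = adj F o\<^sub>L J o\<^sub>L F"
      "bounded_selfadjoint J' \<and> V = adj F o\<^sub>L J' o\<^sub>L F"
    then have "adj F (J (F x)) = adj F (J' (F x))" for x
      by (metis blinfun_apply_blinfun_compose)
    then have "J (F x) = J' (F x)" for x
      by (rule adj_inj_if_dense_range[OF frame_clin[OF F] dense])
    then show "J = J'" by (rule eq_if_eq_on_dense_range[OF dense])
  qed
  from theI'[OF this] show "bounded_selfadjoint (J_of F V)" "V = adj F o\<^sub>L J_of F V o\<^sub>L F"
    by (simp_all add: J_of_def)
qed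

text \<open>
  \<open>B = A (1 + c A)\<^sup>-\<^sup>1\<close> with \<open>1 + c A\<close> invertible, written without inverses: this form is what
  the resolvent identity delivers, and it passes to norm limits, whereas invertibility does
  not pass to limits in general.
\<close>

definition moebius_shift ::
    "real \<Rightarrow> ('a::complex_inner_space \<Rightarrow>\<^sub>L 'a) \<Rightarrow> ('a \<Rightarrow>\<^sub>L 'a) \<Rightarrow> bool" where
  "moebius_shift c A B \<longleftrightarrow> clin A \<and> clin B \<and>
     A - B = c *\<^sub>R (A o\<^sub>L B) \<and> A - B = c *\<^sub>R (B o\<^sub>L A)"

lemma moebius_shift_limit:
  assumes A: "(A \<longlongrightarrow> A0) G" and B: "(B \<longlongrightarrow> B0) G" and G: "G \<noteq> bot"
    and ev: "eventually (\<lambda>y. moebius_shift c (A y) (B y)) G"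
  shows "moebius_shift c A0 B0"
proof -
  have "clin A0" "clin B0"
    using ev by (auto intro!: clin_limit[OF A _ G] clin_limit[OF B _ G]
        elim: eventually_mono simp: moebius_shift_def)
  moreover have D: "((\<lambda>y. A y - B y) \<longlongrightarrow> A0 - B0) G"
    by (intro tendsto_intros A B)
  have "((\<lambda>y. c *\<^sub>R (A y o\<^sub>L B y)) \<longlongrightarrow> c *\<^sub>R (A0 o\<^sub>L B0)) G"
    by (intro tendsto_intros A B)
  then have "((\<lambda>y. A y - B y) \<longlongrightarrow> c *\<^sub>R (A0 o\<^sub>L B0)) G"
    by (rule Lim_transform_eventually) (use ev in eventually_elim, simp add: moebius_shift_def)
  then have "A0 - B0 = c *\<^sub>R (A0 o\<^sub>L B0)" by (rule tendsto_unique[OF G D])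
  moreover have "((\<lambda>y. c *\<^sub>R (B y o\<^sub>L A y)) \<longlongrightarrow> c *\<^sub>R (B0 o\<^sub>L A0)) G"
    by (intro tendsto_intros A B)
  then have "((\<lambda>y. A y - B y) \<longlongrightarrow> c *\<^sub>R (B0 o\<^sub>L A0)) G"
    by (rule Lim_transform_eventually)
      (use ev in eventually_elim, metis moebius_shift_def)
  then have "A0 - B0 = c *\<^sub>R (B0 o\<^sub>L A0)" by (rule tendsto_unique[OF G D])
  ultimately show ?thesis by (simp add: moebius_shift_def)
qed

text \<open>
  The second resolvent identity, once from \<open>H\<close> to \<open>H + c V\<close> and once back, with
  \<open>V = F\<^sup>* J F\<close> substituted: the factors \<open>F\<close> and \<open>F\<^sup>*\<close> are absorbed into the two neighbouring
  sandwiched resolvents.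
\<close>

lemma sandwiched_moebius_shift:
  fixes F :: "'h::chilbert_space \<Rightarrow>\<^sub>L 'k::chilbert_space"
  assumes F: "is_frame F" and V: "V \<in> frame_ops F" and H: "self_adjoint H" and z: "Im z \<noteq> 0"
  shows "moebius_shift c (sandwiched F H z o\<^sub>L J_of F V)
           (sandwiched F (H +\<^sub>O c *\<^sub>R V) z o\<^sub>L J_of F V)"
proof -
  define J where "J = J_of F V"
  define K where "K = H +\<^sub>O c *\<^sub>R V"
  have Fc: "clin F" by (rule frame_clin[OF F])
  have J: "clin J" using J_of_represents(1)[OF F V] by (simp add: J_def bounded_selfadjoint_def)
  have VJ: "V x = adj F (J (F x))" for x
    using J_of_represents(2)[OF F V] by (metis J_def blinfun_apply_blinfun_compose)
  have sV: "bounded_selfadjoint (r *\<^sub>R V)" for r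
    by (intro bounded_selfadjoint_scaleR frame_ops_bounded_selfadjoint[OF Fc V])
  have K: "self_adjoint K" unfolding K_def by (intro self_adjoint_op_plus H sV)
  have HK: "H = K +\<^sub>O (- c) *\<^sub>R V"
    by (auto simp: K_def mem_op_plus blinfun.bilinear_simps)
  have res: "resolvent H z x - resolvent K z x = c *\<^sub>R resolvent H z (V (resolvent K z x))" for x
    using second_resolvent_identity[OF H K[unfolded K_def] z, of x]
    by (simp add: K_def blinfun.bilinear_simps)
  have res': "resolvent H z x - resolvent K z x = c *\<^sub>R resolvent K z (V (resolvent H z x))" for x
    using second_resolvent_identity[OF K, of "(- c) *\<^sub>R V" z x, folded HK, OF H z]
    by (simp add: blinfun.bilinear_simps algebra_simps)
  have Fres: "F (resolvent H z x) - F (resolvent K z x) = c *\<^sub>R F (resolvent H z (V (resolvent K z x)))"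
    and Fres': "F (resolvent H z x) - F (resolvent K z x) = c *\<^sub>R F (resolvent K z (V (resolvent H z x)))" for x
    by (metis res blinfun.diff_right blinfun.scaleR_right)
      (metis res' blinfun.diff_right blinfun.scaleR_right)
  have "clin (sandwiched F H z o\<^sub>L J)" "clin (sandwiched F K z o\<^sub>L J)"
    unfolding sandwiched_def
    by (intro clin_compose Fc J clin_adj clin_resolvent H K z)+
  moreover have "(sandwiched F H z o\<^sub>L J) - (sandwiched F K z o\<^sub>L J) =
      c *\<^sub>R ((sandwiched F H z o\<^sub>L J) o\<^sub>L (sandwiched F K z o\<^sub>L J))"
    by (rule blinfun_eqI)
      (simp add: sandwiched_def blinfun.diff_left blinfun.scaleR_left Fres VJ)
  moreover have "(sandwiched F H z o\<^sub>L J) - (sandwiched F K z o\<^sub>L J) =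
      c *\<^sub>R ((sandwiched F K z o\<^sub>L J) o\<^sub>L (sandwiched F H z o\<^sub>L J))"
    by (rule blinfun_eqI)
      (simp add: sandwiched_def blinfun.diff_left blinfun.scaleR_left Fres' VJ)
  ultimately show ?thesis by (simp add: moebius_shift_def J_def K_def)
qed

lemma sandwiched_tendsto_limit:
  assumes "regular_at l F H"
  shows "((\<lambda>y. sandwiched F H (Complex l y)) \<longlongrightarrow> sandwiched_limit F H l) (at_right 0)"
  using assms unfolding Lambda_def sandwiched_limit_def
  by (auto simp: tendsto_Lim)

lemma sandwiched_limit_moebius_shift:
  fixes F :: "'h::chilbert_space \<Rightarrow>\<^sub>L 'k::chilbert_space"
  assumes F: "is_frame F" and V: "V \<in> frame_ops F" and H: "self_adjoint H"
    and reg: "regular_at l F H" "regular_at l F (H +\<^sub>O c *\<^sub>R V)"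
  shows "moebius_shift c (sandwiched_limit F H l o\<^sub>L J_of F V)
           (sandwiched_limit F (H +\<^sub>O c *\<^sub>R V) l o\<^sub>L J_of F V)"
proof (rule moebius_shift_limit)
  show "((\<lambda>y. sandwiched F H (Complex l y) o\<^sub>L J_of F V) \<longlongrightarrow>
      sandwiched_limit F H l o\<^sub>L J_of F V) (at_right 0)"
    by (intro tendsto_intros sandwiched_tendsto_limit reg)
  show "((\<lambda>y. sandwiched F (H +\<^sub>O c *\<^sub>R V) (Complex l y) o\<^sub>L J_of F V) \<longlongrightarrow>
      sandwiched_limit F (H +\<^sub>O c *\<^sub>R V) l o\<^sub>L J_of F V) (at_right 0)"
    by (intro tendsto_intros sandwiched_tendsto_limit reg)
  show "\<forall>\<^sub>F y in at_right 0. moebius_shift c (sandwiched F H (Complex l y) o\<^sub>L J_of F V)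
           (sandwiched F (H +\<^sub>O c *\<^sub>R V) (Complex l y) o\<^sub>L J_of F V)"
    using eventually_at_right_less[of 0]
    by eventually_elim (intro sandwiched_moebius_shift F V H, simp)
qed simp


section \<open>Poles under a change of base point\<close>

lemma inv_op_eqI:
  assumes "A o\<^sub>L B = id_blinfun" "B o\<^sub>L A = id_blinfun"
  shows "inv_op A = B"
proof -
  have uniq: "C = B" if "A o\<^sub>L C = id_blinfun" for C
  proof (rule blinfun_eqI)
    fix x
    have "C x = B (A (C x))" using assms(2) by (metis blinfun_apply_blinfun_compose blinfun_apply_id_blinfun)
    also have "A (C x) = x" using that by (metis blinfun_apply_blinfun_compose blinfun_apply_id_blinfun)
    finally show "C x = B x" .
  qed
  have "(THE B. A o\<^sub>L B = id_blinfun \<and> B o\<^sub>L A = id_blinfun) = B"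
    by (rule the_equality) (use assms uniq in blast)+
  moreover have "\<exists>B. A o\<^sub>L B = id_blinfun \<and> B o\<^sub>L A = id_blinfun" using assms by blast
  ultimately show ?thesis by (simp only: inv_op_def if_True)
qed

lemma blinfun_compose_assoc: "(A o\<^sub>L B) o\<^sub>L C = A o\<^sub>L (B o\<^sub>L C)"
  by (rule blinfun_eqI) simp

lemma blinfun_compose_id [simp]: "A o\<^sub>L id_blinfun = A" "id_blinfun o\<^sub>L A = A"
  by (rule blinfun_eqI, simp)+

text \<open>
  Valid also where \<open>X\<close> is not invertible, since then neither is \<open>X D\<close> and both sides are the
  dummy value \<open>0\<close>.  So pole functions can be compared at all points at once.
\<close>

lemma inv_op_compose_invertible:
  assumes CD: "C o\<^sub>L D = id_blinfun" "D o\<^sub>L C = id_blinfun"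
  shows "inv_op (X o\<^sub>L D) = C o\<^sub>L inv_op X"
proof (cases "\<exists>Y. X o\<^sub>L Y = id_blinfun \<and> Y o\<^sub>L X = id_blinfun")
  case True
  then obtain Y where Y: "X o\<^sub>L Y = id_blinfun" "Y o\<^sub>L X = id_blinfun" by blast
  have "inv_op (X o\<^sub>L D) = C o\<^sub>L Y"
    by (rule inv_op_eqI) (metis CD Y blinfun_compose_assoc blinfun_compose_id)+
  then show ?thesis using inv_op_eqI[OF Y] by simp
next
  case False
  have "\<not> (\<exists>Z. (X o\<^sub>L D) o\<^sub>L Z = id_blinfun \<and> Z o\<^sub>L (X o\<^sub>L D) = id_blinfun)"
  proof
    assume "\<exists>Z. (X o\<^sub>L D) o\<^sub>L Z = id_blinfun \<and> Z o\<^sub>L (X o\<^sub>L D) = id_blinfun"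
    then obtain Z where Z: "(X o\<^sub>L D) o\<^sub>L Z = id_blinfun" "Z o\<^sub>L (X o\<^sub>L D) = id_blinfun" by blast
    have "X o\<^sub>L (D o\<^sub>L Z) = id_blinfun" using Z by (simp add: blinfun_compose_assoc)
    moreover have "(D o\<^sub>L Z) o\<^sub>L X = id_blinfun"
      using Z(2) CD by (metis blinfun_compose_assoc blinfun_compose_id)
    ultimately show False using False by blast
  qed
  then have "inv_op (X o\<^sub>L D) = 0" by (simp only: inv_op_def if_False)
  moreover have "inv_op X = 0" using False by (simp only: inv_op_def if_False)
  ultimately show ?thesis by simp
qed

lemma moebius_shift_apply:
  assumes "moebius_shift c A B"
  shows "c *\<^sub>R A (B x) = A x - B x" "c *\<^sub>R B (A x) = A x - B x"
  using assms unfolding moebius_shift_def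
  by (metis blinfun.diff_left blinfun.scaleR_left blinfun_apply_blinfun_compose)+

lemma moebius_shift_invertible:
  assumes "moebius_shift c A B"
  shows "(id_blinfun + c *\<^sub>R A) o\<^sub>L (id_blinfun - c *\<^sub>R B) = id_blinfun"
    and "(id_blinfun - c *\<^sub>R B) o\<^sub>L (id_blinfun + c *\<^sub>R A) = id_blinfun"
  by (rule blinfun_eqI, simp add: blinfun.bilinear_simps moebius_shift_apply[OF assms]
      algebra_simps)+

text \<open>
  Because \<open>norm (C f) \<le> norm C * norm f\<close>.  Used with \<open>C\<close> and with its inverse, it shows that an
  invertible factor neither creates nor removes poles.
\<close>

lemma filterlim_at_infinity_compose_left:
  fixes f :: "'c \<Rightarrow> 'a::real_normed_vector \<Rightarrow>\<^sub>L 'b::real_normed_vector"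
    and C :: "'b \<Rightarrow>\<^sub>L 'd::real_normed_vector"
  assumes "filterlim (\<lambda>x. C o\<^sub>L f x) at_infinity G"
  shows "filterlim f at_infinity G"
  unfolding filterlim_at_infinity[OF order_refl]
proof (intro allI impI)
  fix r :: real assume r: "r > 0"
  have "eventually (\<lambda>x. r * (norm C + 1) \<le> norm (C o\<^sub>L f x)) G"
    using assms r unfolding filterlim_at_infinity[OF order_refl]
    by (metis add_nonneg_pos mult_pos_pos norm_ge_zero zero_less_one)
  then show "eventually (\<lambda>x. r \<le> norm (f x)) G"
  proof eventually_elim
    case (elim x)
    also have "norm (C o\<^sub>L f x) \<le> norm C * norm (f x)" by (rule norm_blinfun_compose)
    also have "\<dots> \<le> (norm C + 1) * norm (f x)" by (intro mult_right_mono) auto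
    finally have "(norm C + 1) * r \<le> (norm C + 1) * norm (f x)" by (simp add: mult.commute)
    moreover have "norm C + 1 > 0" by (simp add: add_nonneg_pos)
    ultimately show ?case by simp
  qed
qed

text \<open>
  From \<open>1 + \<sigma> B = (1 + (\<sigma> + c) A) (1 - c B)\<close> and the invertibility of the last factor.
\<close>

lemma is_pole_moebius_shift:
  assumes ms: "moebius_shift c A B"
  shows "is_pole (pole_function B) \<sigma> \<longleftrightarrow> is_pole (pole_function A) (\<sigma> + of_real c)"
proof -
  define C where "C = id_blinfun + c *\<^sub>R A"
  define D where "D = id_blinfun - c *\<^sub>R B"
  have CD: "C o\<^sub>L D = id_blinfun" "D o\<^sub>L C = id_blinfun"
    using moebius_shift_invertible[OF ms] by (auto simp: C_def D_def)
  have AD: "A (D x) = B x" for x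
    by (simp add: D_def blinfun.bilinear_simps moebius_shift_apply[OF ms])
  have factor: "id_blinfun + scaleC_op \<tau> B =
      (id_blinfun + scaleC_op (of_real c + \<tau>) A) o\<^sub>L D" for \<tau>
    by (rule blinfun_eqI)
      (simp add: blinfun.add_left scaleC_op.rep_eq AD scaleC_add_left flip: scaleR_scaleC,
        simp add: D_def blinfun.bilinear_simps)
  have pf: "pole_function B \<tau> = C o\<^sub>L pole_function A (of_real c + \<tau>)" for \<tau>
    unfolding pole_function_def factor by (rule inv_op_compose_invertible[OF CD])
  let ?f = "pole_function A \<circ> (+) (of_real c)"
  have "is_pole (pole_function B) \<sigma> \<longleftrightarrow> filterlim (\<lambda>\<tau>. C o\<^sub>L ?f \<tau>) at_infinity (at \<sigma>)"
    by (simp add: is_pole_def pf[abs_def] o_def)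
  also have "\<dots> \<longleftrightarrow> filterlim ?f at_infinity (at \<sigma>)"
  proof
    assume "filterlim ?f at_infinity (at \<sigma>)"
    then have "filterlim (\<lambda>\<tau>. D o\<^sub>L (C o\<^sub>L ?f \<tau>)) at_infinity (at \<sigma>)"
      by (simp add: CD o_def flip: blinfun_compose_assoc)
    then show "filterlim (\<lambda>\<tau>. C o\<^sub>L ?f \<tau>) at_infinity (at \<sigma>)"
      by (rule filterlim_at_infinity_compose_left)
  qed (rule filterlim_at_infinity_compose_left)
  also have "\<dots> \<longleftrightarrow> is_pole (pole_function A) (\<sigma> + of_real c)"
    using is_pole_shift_iff[of "pole_function A" "of_real c" \<sigma>] by (simp add: is_pole_def o_def)
  finally show ?thesis .
qed

text \<open>
  As \<open>g\<close> and \<open>b\<close> commute, \<open>f\<^sup>k = b\<^sup>k g\<^sup>k\<close>, and \<open>b\<^sup>k\<close> kills only \<open>0\<close>.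
\<close>

lemma funpow_eq_zero_iff_of_injective_factor:
  assumes f: "\<And>v. f v = b (g v)" and comm: "\<And>v. g (b v) = b (g v)"
    and b: "\<And>v. b v = 0 \<longleftrightarrow> v = 0"
  shows "(f ^^ k) x = 0 \<longleftrightarrow> (g ^^ k) x = 0"
proof -
  have gb: "g ((b ^^ k) v) = (b ^^ k) (g v)" for k v
    by (induction k) (simp_all add: comm)
  have "(f ^^ k) x = (b ^^ k) ((g ^^ k) x)" for k
    by (induction k) (simp_all add: f gb)
  moreover have "(b ^^ k) v = 0 \<longleftrightarrow> v = 0" for k v
    by (induction k) (simp_all add: b)
  ultimately show ?thesis by simp
qed

text \<open>
  With \<open>\<tau> = \<sigma> + c\<close> the operator \<open>B + 1/\<sigma>\<close> equals \<open>A + 1/\<tau>\<close> times the invertible operator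
  \<open>(\<tau>/\<sigma>) (1 - c B)\<close>, and the two factors commute; so all their powers have equal kernels.
\<close>

lemma root_space_moebius_shift:
  assumes ms: "moebius_shift c A B" and \<sigma>: "\<sigma> \<noteq> 0" "\<sigma> + of_real c \<noteq> 0"
  shows "root_space B (- 1 / \<sigma>) = root_space A (- 1 / (\<sigma> + of_real c))"
proof -
  define \<tau> where "\<tau> = \<sigma> + of_real c"
  define k where "k = \<tau> / \<sigma>"
  define D where "D = id_blinfun - c *\<^sub>R B"
  define f where "f v = B v - (- 1 / \<sigma>) *\<^sub>C v" for v
  define g where "g v = A v - (- 1 / \<tau>) *\<^sub>C v" for v
  define b where "b v = k *\<^sub>C D v" for v
  have \<tau>0: "\<tau> \<noteq> 0" and k0: "k \<noteq> 0" using \<sigma> by (auto simp: \<tau>_def k_def)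
  have cA: "clin A" and cB: "clin B" using ms by (auto simp: moebius_shift_def)
  have AD: "A (D x) = B x" "D (A x) = B x" for x
    by (simp_all add: D_def blinfun.bilinear_simps moebius_shift_apply[OF ms])
  have cD: "D (d *\<^sub>C x) = d *\<^sub>C D x" for d x
    using cB by (simp add: D_def clin_def blinfun.bilinear_simps scaleC_diff_right
        scaleR_scaleC scaleC_scaleC mult.commute)
  have f_eq: "f v = k *\<^sub>C (B v - (- 1 / \<tau>) *\<^sub>C D v)" for v
  proof -
    have "B v - (- 1 / \<tau>) *\<^sub>C D v = B v - ((- 1 / \<tau>) *\<^sub>C v - (- 1 / \<tau> * of_real c) *\<^sub>C B v)"
      by (simp add: D_def blinfun.bilinear_simps scaleC_diff_right scaleR_scaleC scaleC_scaleC)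
    also have "\<dots> = (1 + (- 1 / \<tau> * of_real c)) *\<^sub>C B v - (- 1 / \<tau>) *\<^sub>C v"
      by (simp only: scaleC_add_left scaleC_one diff_diff_eq2)
    also have "1 + (- 1 / \<tau> * of_real c) = \<sigma> / \<tau>"
      using \<tau>0 by (simp add: \<tau>_def field_simps)
    finally have "k *\<^sub>C (B v - (- 1 / \<tau>) *\<^sub>C D v) = 1 *\<^sub>C B v - (- 1 / \<sigma>) *\<^sub>C v"
      using \<tau>0 \<sigma>(1) by (simp add: scaleC_diff_right scaleC_scaleC k_def)
    then show ?thesis by (simp only: f_def scaleC_one)
  qed
  have "f v = b (g v)" for v
    by (simp add: f_eq b_def g_def blinfun.diff_right AD cD)
  moreover have "g (b v) = b (g v)" for v
    using cA by (simp add: b_def g_def blinfun.diff_right AD cD clin_def scaleC_diff_right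
        scaleC_scaleC mult.commute)
  moreover have "b v = 0 \<longleftrightarrow> v = 0" for v
  proof
    assume "b v = 0"
    then have "norm (b v) = 0" by simp
    then have "D v = 0" using k0 by (simp add: b_def norm_scaleC)
    then have "(id_blinfun + c *\<^sub>R A) (D v) = 0" by simp
    then show "v = 0"
      using moebius_shift_invertible(1)[OF ms]
      by (metis D_def blinfun_apply_blinfun_compose blinfun_apply_id_blinfun)
  next
    assume "v = 0"
    then have "norm (b v) = 0" by (simp add: b_def norm_scaleC)
    then show "b v = 0" by simp
  qed
  ultimately have "(f ^^ n) v = 0 \<longleftrightarrow> (g ^^ n) v = 0" for n v
    by (rule funpow_eq_zero_iff_of_injective_factor)
  then show ?thesis
    by (simp add: root_space_def f_def[abs_def] g_def[abs_def] \<tau>_def)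
qed

lemma pole_mult_moebius_shift:
  assumes "moebius_shift c A B" "\<sigma> \<noteq> 0" "\<sigma> + of_real c \<noteq> 0"
  shows "pole_mult B \<sigma> = pole_mult A (\<sigma> + of_real c)"
  using root_space_moebius_shift[OF assms] by (simp add: pole_mult_def alg_mult_def)

lemma count_poles_moebius_shift:
  assumes ms: "moebius_shift c A B" and "0 \<notin> S" "0 \<notin> T"
    and ST: "\<And>\<sigma>. \<sigma> + of_real c \<in> T \<longleftrightarrow> \<sigma> \<in> S"
  shows "count_poles B S = count_poles A T"
  unfolding count_poles_def
proof (rule sum.reindex_bij_witness[of _ "\<lambda>\<sigma>. \<sigma> - of_real c" "\<lambda>\<sigma>. \<sigma> + of_real c"])
  fix \<sigma> assume *: "\<sigma> \<in> {\<sigma> \<in> S. is_pole (pole_function B) \<sigma>}"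
  then show "\<sigma> + of_real c \<in> {\<sigma> \<in> T. is_pole (pole_function A) \<sigma>}"
    using is_pole_moebius_shift[OF ms] ST by auto
  show "pole_mult A (\<sigma> + of_real c) = pole_mult B \<sigma>"
  proof (rule pole_mult_moebius_shift[OF ms, symmetric])
    show "\<sigma> \<noteq> 0" "\<sigma> + of_real c \<noteq> 0"
      using * \<open>0 \<notin> S\<close> \<open>0 \<notin> T\<close> ST[of \<sigma>] by auto
  qed
next
  fix \<tau> assume "\<tau> \<in> {\<sigma> \<in> T. is_pole (pole_function A) \<sigma>}"
  then show "\<tau> - of_real c \<in> {\<sigma> \<in> S. is_pole (pole_function B) \<sigma>}"
    using is_pole_moebius_shift[OF ms, of "\<tau> - of_real c"] ST[of "\<tau> - of_real c"] by simp
qed simp_all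


section \<open>Independence of the base point\<close>

text \<open>
  Only the equivalence of the two defining conditions is shown, for every candidate value \<open>n\<close>;
  the definite descriptions are then equal.  The set \<open>P\<close> will be a half-plane.
\<close>

lemma N_half_change_base_point:
  fixes F :: "'h::chilbert_space \<Rightarrow>\<^sub>L 'k::chilbert_space"
  assumes F: "is_frame F" and V: "V \<in> frame_ops F" and H: "self_adjoint H"
    and reg: "regular_at l F H" "regular_at l F (H +\<^sub>O c *\<^sub>R V)"
    and s: "s \<noteq> 0" "s + c \<noteq> 0"
    and P: "\<And>\<sigma>. \<sigma> + of_real c \<in> P \<longleftrightarrow> \<sigma> \<in> P"
  shows "N_half P l F (H +\<^sub>O c *\<^sub>R V) V (s + c) = N_half P l F H V s"
proof -
  define A where "A y = sandwiched F H (Complex l y) o\<^sub>L J_of F V" for y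
  define B where "B y = sandwiched F (H +\<^sub>O c *\<^sub>R V) (Complex l y) o\<^sub>L J_of F V" for y
  have mult: "pole_mult (sandwiched_limit F (H +\<^sub>O c *\<^sub>R V) l o\<^sub>L J_of F V) (- of_real (s + c)) =
      pole_mult (sandwiched_limit F H l o\<^sub>L J_of F V) (- of_real s)"
  proof -
    have "- complex_of_real (s + c) + of_real c = - of_real s" by simp
    moreover have "- complex_of_real (s + c) \<noteq> 0" "- complex_of_real s \<noteq> 0"
      using s by (simp_all del: of_real_add)
    ultimately show ?thesis
      using pole_mult_moebius_shift[OF sandwiched_limit_moebius_shift[OF F V H reg]] by metis
  qed
  have cnt: "count_poles (B y) (ball (- of_real (s + c)) \<epsilon> \<inter> Q) =
      count_poles (A y) (ball (- of_real s) \<epsilon> \<inter> Q)"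
    \<comment> \<open>The bound on \<open>\<epsilon>\<close> keeps \<open>\<sigma> = 0\<close>, where \<open>- 1 / \<sigma>\<close> is meaningless, out of both discs.\<close>
    if y: "y > 0" and \<epsilon>: "\<epsilon> < min \<bar>s\<bar> \<bar>s + c\<bar>" and Q: "\<And>\<sigma>. \<sigma> + of_real c \<in> Q \<longleftrightarrow> \<sigma> \<in> Q" for y \<epsilon> Q
  proof (rule count_poles_moebius_shift)
    show "moebius_shift c (A y) (B y)"
      unfolding A_def B_def by (intro sandwiched_moebius_shift F V H) (use y in simp)
    show "0 \<notin> ball (- complex_of_real (s + c)) \<epsilon> \<inter> Q" "0 \<notin> ball (- complex_of_real s) \<epsilon> \<inter> Q"
      using \<epsilon> by (simp_all add: norm_of_real del: of_real_add)
    show "\<sigma> + of_real c \<in> ball (- of_real s) \<epsilon> \<inter> Q \<longleftrightarrow> \<sigma> \<in> ball (- of_real (s + c)) \<epsilon> \<inter> Q" for \<sigma>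
    proof -
      have "- of_real s - (\<sigma> + of_real c) = - of_real (s + c) - \<sigma>" by simp
      then show ?thesis using Q by (simp only: Int_iff mem_ball dist_norm)
    qed
  qed
  have "(\<forall>\<^sub>F \<epsilon> in at_right 0. \<forall>\<^sub>F y in at_right 0.
       count_poles (B y) (ball (- of_real (s + c)) \<epsilon>) = N \<and>
       count_poles (B y) (ball (- of_real (s + c)) \<epsilon> \<inter> P) = n) \<longleftrightarrow>
     (\<forall>\<^sub>F \<epsilon> in at_right 0. \<forall>\<^sub>F y in at_right 0.
       count_poles (A y) (ball (- of_real s) \<epsilon>) = N \<and>
       count_poles (A y) (ball (- of_real s) \<epsilon> \<inter> P) = n)" for N n
  proof (rule eventually_subst)
    have "\<forall>\<^sub>F \<epsilon> in at_right 0. \<epsilon> < min \<bar>s\<bar> \<bar>s + c\<bar>"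
      using s by (intro eventually_at_rightI[of 0 "min \<bar>s\<bar> \<bar>s + c\<bar>"]) auto
    then show "\<forall>\<^sub>F \<epsilon> in at_right 0.
      (\<forall>\<^sub>F y in at_right 0. count_poles (B y) (ball (- of_real (s + c)) \<epsilon>) = N \<and>
         count_poles (B y) (ball (- of_real (s + c)) \<epsilon> \<inter> P) = n) =
      (\<forall>\<^sub>F y in at_right 0. count_poles (A y) (ball (- of_real s) \<epsilon>) = N \<and>
         count_poles (A y) (ball (- of_real s) \<epsilon> \<inter> P) = n)"
    proof eventually_elim
      case (elim \<epsilon>)
      show ?case
      proof (rule eventually_subst)
        show "\<forall>\<^sub>F y in at_right 0.
          (count_poles (B y) (ball (- of_real (s + c)) \<epsilon>) = N \<and>
           count_poles (B y) (ball (- of_real (s + c)) \<epsilon> \<inter> P) = n) =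
          (count_poles (A y) (ball (- of_real s) \<epsilon>) = N \<and>
           count_poles (A y) (ball (- of_real s) \<epsilon> \<inter> P) = n)"
          using eventually_at_right_less[of 0]
        proof eventually_elim
          case (elim y)
          then show ?case
            using cnt[OF elim \<open>\<epsilon> < min \<bar>s\<bar> \<bar>s + c\<bar>\<close> P] cnt[OF elim \<open>\<epsilon> < min \<bar>s\<bar> \<bar>s + c\<bar>\<close>, of UNIV]
            by simp
        qed
      qed
    qed
  qed
  then show ?thesis unfolding N_half_def mult A_def B_def by simp
qed

theorem theorem2p7:
  fixes F :: "'h::{chilbert_space, second_countable_topology} \<Rightarrow>\<^sub>L 'k::chilbert_space"
    and Hstar H0 :: "('h \<times> 'h) set"
    and V :: "'h \<Rightarrow>\<^sub>L 'h"
    and lam s t :: real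
  assumes "is_frame F"
    and "self_adjoint Hstar"
    and "essentially_regular (affine_ops Hstar F) F lam"
    and "H0 \<in> affine_ops Hstar F"
    and "resonant_at lam F H0"
    and "V \<in> frame_ops F"
    and "regularizing lam F H0 V"
    and "regular_at lam F (H0 +\<^sub>O s *\<^sub>R V)"
    and "regular_at lam F (H0 +\<^sub>O t *\<^sub>R V)"
  shows "resonance_index lam F H0 V s = resonance_index lam F H0 V t"
proof -
  have Fc: "clin F" by (rule frame_clin[OF assms(1)])
  obtain W where W: "W \<in> frame_ops F" and H0: "H0 = Hstar +\<^sub>O W"
    using assms(4) by (auto simp: affine_ops_def)
  have sa: "self_adjoint (H0 +\<^sub>O r *\<^sub>R V)" for r
    unfolding H0 using assms(2,6) W
    by (intro self_adjoint_op_plus bounded_selfadjoint_scaleR frame_ops_bounded_selfadjoint[OF Fc])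
  \<comment> \<open>The resonant operator lies on the line at \<open>r = 0\<close>.\<close>
  have "H0 +\<^sub>O 0 *\<^sub>R V = H0" by (auto simp: mem_op_plus)
  then have nz: "s \<noteq> 0" "t \<noteq> 0" using assms(5,8,9) by auto
  have line: "H0 +\<^sub>O s *\<^sub>R V +\<^sub>O (t - s) *\<^sub>R V = H0 +\<^sub>O t *\<^sub>R V"
    by (simp add: op_plus_assoc flip: scaleR_add_left)
  have "N_half P lam F (H0 +\<^sub>O t *\<^sub>R V) V t = N_half P lam F (H0 +\<^sub>O s *\<^sub>R V) V s"
    if "\<And>\<sigma>. \<sigma> + of_real (t - s) \<in> P \<longleftrightarrow> \<sigma> \<in> P" for P
    using N_half_change_base_point[OF assms(1,6) sa assms(8), of "t - s" s P] that assms(9) nz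
    by (simp add: line)
  then show ?thesis
    by (simp add: resonance_index_def N_plus_def N_minus_def)
qed

end
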